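(* Let $G$ be a finite, simple, connected graph on $n$ vertices. Then $\sigma^-(G)\le\lceil n/2\rceil\lfloor n/2\rfloor$, and moreover: (1) $\sigma^-(G)=\lceil n/2\rceil\lfloor n/2\rfloor$ if and only if $G=K_n$; (2) $\sigma^-(G)=\lceil n/2\rceil\lfloor n/2\rfloor-1$ if and only if $G=K_n-e$; (3) $\sigma^-(G)=\lceil n/2\rceil\lfloor n/2\rfloor-2$ if and only if $G\in\{K_n-\triangle,\,K_n-2e,\,K_n-P_2\}$.
   Context: A parity-signature of $G$ is a map $\sigma:E(G)\to\{1,-1\}$ for which there is a partition $V(G)=V_1\cup V_2$ with $||V_1|-|V_2||\le1$ such that an edge has sign $-1$ (is negative) exactly when its ends lie in different sets. $\sigma^-(G)$ (the $rna$ number) is the minimum number of negative edges over all parity-signatures of $G$; equivalently, the minimum of $|E(V_1,V_2)|$ over such partitions. $K_n-e$ is $K_n$ minus one edge, $K_n-2e$ is $K_n$ minus two nonadjacent edges, $K_n-P_2$ is $K_n$ minus two adjacent edges, and $K_n-\triangle$ is $K_n$ minus the three edges of a triangle. *)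

theory Defs
  imports Complex_Main
begin

record 'a ugraph =
  verts :: "'a set"
  edges :: "'a set set"

definition all_edges :: "'a set \<Rightarrow> 'a set set" where
  "all_edges V = {{u, v} | u v. u \<in> V \<and> v \<in> V \<and> u \<noteq> v}"

definition finite_simple_graph :: "'a ugraph \<Rightarrow> bool" where
  "finite_simple_graph G \<longleftrightarrow> finite (verts G) \<and> edges G \<subseteq> all_edges (verts G)"

definition connected_graph :: "'a ugraph \<Rightarrow> bool" where
  "connected_graph G \<longleftrightarrow> verts G \<noteq> {} \<and>
     (\<forall>u\<in>verts G. \<forall>v\<in>verts G. (\<lambda>x y. {x, y} \<in> edges G)\<^sup>*\<^sup>* u v)"

definition graph_iso :: "'a ugraph \<Rightarrow> 'b ugraph \<Rightarrow> bool" (infix \<open>\<cong>\<^sub>g\<close> 50) where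
  "G \<cong>\<^sub>g H \<longleftrightarrow> (\<exists>f. bij_betw f (verts G) (verts H) \<and>
     (\<forall>u\<in>verts G. \<forall>v\<in>verts G. {u, v} \<in> edges G \<longleftrightarrow> {f u, f v} \<in> edges H))"

definition delete_edges :: "'a ugraph \<Rightarrow> 'a set set \<Rightarrow> 'a ugraph" where
  "delete_edges G F = \<lparr>verts = verts G, edges = edges G - F\<rparr>"

definition complete_graph :: "nat \<Rightarrow> nat ugraph" where
  "complete_graph n = \<lparr>verts = {..<n}, edges = all_edges {..<n}\<rparr>"

text \<open>The graphs obtained from the complete graph by deleting edges are determined only up to
  isomorphism, hence the following predicates. The deleted edges are required to be edges of the
  complete graph, so that a predicate holds of no graph when \<open>n\<close> is too small for the
  deletion to make sense.\<close>

definition is_K :: "nat \<Rightarrow> 'a ugraph \<Rightarrow> bool" where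
  "is_K n G \<longleftrightarrow> G \<cong>\<^sub>g complete_graph n"

definition is_K_minus_e :: "nat \<Rightarrow> 'a ugraph \<Rightarrow> bool" where
  "is_K_minus_e n G \<longleftrightarrow>
     (\<exists>e\<in>edges (complete_graph n). G \<cong>\<^sub>g delete_edges (complete_graph n) {e})"

definition is_K_minus_2e :: "nat \<Rightarrow> 'a ugraph \<Rightarrow> bool" where
  "is_K_minus_2e n G \<longleftrightarrow>
     (\<exists>e\<in>edges (complete_graph n). \<exists>f\<in>edges (complete_graph n).
        e \<inter> f = {} \<and> G \<cong>\<^sub>g delete_edges (complete_graph n) {e, f})"

definition is_K_minus_P2 :: "nat \<Rightarrow> 'a ugraph \<Rightarrow> bool" where
  "is_K_minus_P2 n G \<longleftrightarrow>
     (\<exists>e\<in>edges (complete_graph n). \<exists>f\<in>edges (complete_graph n).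
        e \<noteq> f \<and> e \<inter> f \<noteq> {} \<and> G \<cong>\<^sub>g delete_edges (complete_graph n) {e, f})"

definition is_K_minus_triangle :: "nat \<Rightarrow> 'a ugraph \<Rightarrow> bool" where
  "is_K_minus_triangle n G \<longleftrightarrow>
     (\<exists>a\<in>verts (complete_graph n). \<exists>b\<in>verts (complete_graph n). \<exists>c\<in>verts (complete_graph n).
        a \<noteq> b \<and> b \<noteq> c \<and> a \<noteq> c \<and>
        G \<cong>\<^sub>g delete_edges (complete_graph n) {{a, b}, {b, c}, {a, c}})"

text \<open>The sets \<open>V1\<close> and \<open>V2\<close> may be empty, which is needed for the one-vertex graph.
  Values of a signature outside the edge set are irrelevant.\<close>

definition balanced_partition :: "'a set \<Rightarrow> 'a set \<Rightarrow> 'a set \<Rightarrow> bool" where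
  "balanced_partition V V1 V2 \<longleftrightarrow>
     V1 \<union> V2 = V \<and> V1 \<inter> V2 = {} \<and> \<bar>int (card V1) - int (card V2)\<bar> \<le> 1"

definition parity_signature :: "'a ugraph \<Rightarrow> ('a set \<Rightarrow> int) \<Rightarrow> bool" where
  "parity_signature G \<sigma> \<longleftrightarrow>
     (\<forall>e\<in>edges G. \<sigma> e \<in> {1, -1}) \<and>
     (\<exists>V1 V2. balanced_partition (verts G) V1 V2 \<and>
        (\<forall>e\<in>edges G. \<sigma> e = -1 \<longleftrightarrow> (\<exists>u\<in>V1. \<exists>v\<in>V2. e = {u, v})))"

definition negative_edges :: "'a ugraph \<Rightarrow> ('a set \<Rightarrow> int) \<Rightarrow> 'a set set" where
  "negative_edges G \<sigma> = {e \<in> edges G. \<sigma> e = -1}"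

definition rna :: "'a ugraph \<Rightarrow> nat" where
  "rna G = Min {card (negative_edges G \<sigma>) | \<sigma>. parity_signature G \<sigma>}"

text \<open>The minimum is taken over a finite nonempty set:\<close>

lemma finite_rna_set:
  assumes "finite_simple_graph G"
  shows "finite {card (negative_edges G \<sigma>) | \<sigma>. parity_signature G \<sigma>}"
proof -
  have "edges G \<subseteq> Pow (verts G)"
    using assms by (auto simp: finite_simple_graph_def all_edges_def)
  then have "finite (edges G)"
    using assms by (auto simp: finite_simple_graph_def intro: finite_subset)
  then have "{card (negative_edges G \<sigma>) | \<sigma>. parity_signature G \<sigma>} \<subseteq> {..card (edges G)}"
    by (auto simp: negative_edges_def intro!: card_mono)
  then show ?thesis by (rule finite_subset) simp
qed

lemma ex_parity_signature:
  assumes "finite_simple_graph G"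
  shows "\<exists>\<sigma>. parity_signature G \<sigma>"
proof -
  let ?V = "verts G"
  have fin: "finite ?V" using assms by (simp add: finite_simple_graph_def)
  obtain V1 where V1: "V1 \<subseteq> ?V" "card V1 = card ?V div 2" "finite V1"
    using obtain_subset_with_card_n[of "card ?V div 2" ?V] by auto
  have "card (?V - V1) = card ?V - card ?V div 2"
    using V1 by (simp add: card_Diff_subset)
  then have "balanced_partition ?V V1 (?V - V1)"
    using V1 unfolding balanced_partition_def by auto
  then have "parity_signature G (\<lambda>e. if \<exists>u\<in>V1. \<exists>v\<in>?V - V1. e = {u, v} then -1 else 1)"
    unfolding parity_signature_def by (intro conjI exI[of _ V1] exI[of _ "?V - V1"]) auto
  then show ?thesis by blast
qed

end

theory Submission
  imports Defs
begin

text \<open>A balanced partition of the vertex set is crossed by exactly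
  \<open>\<lceil>n/2\<rceil> \<lfloor>n/2\<rfloor>\<close> pairs of vertices, so \<open>\<sigma>\<^sup>-(G)\<close> falls short of this number by the
  largest number of edges of the complement \<open>H\<close> of \<open>G\<close> that a balanced partition can cut.
  If \<open>H\<close> has at most two edges, all of them can be cut at once; at most two edges of a triangle are
  ever cut. If \<open>H\<close> has at least three edges and is not a triangle, then three of its
  edges form a matching, a two-edge path with a disjoint edge, a three-edge path or a star. All three
  can be cut simultaneously, except for the star if \<open>n = 4\<close>; but then its centre is isolated
  in \<open>G\<close>, contradicting connectedness.\<close>

definition crossing :: "'a set \<Rightarrow> 'a set \<Rightarrow> 'a set set" where
  "crossing A B = {{u, v} | u v. u \<in> A \<and> v \<in> B}"

definition non_edges :: "'a ugraph \<Rightarrow> 'a set set" where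
  "non_edges G = all_edges (verts G) - edges G"

lemma doubleton_in_all_edges [simp]:
  "{u, v} \<in> all_edges V \<longleftrightarrow> u \<in> V \<and> v \<in> V \<and> u \<noteq> v"
  by (auto simp: all_edges_def doubleton_eq_iff)

lemma all_edgesE:
  assumes "e \<in> all_edges V"
  obtains u v where "e = {u, v}" "u \<in> V" "v \<in> V" "u \<noteq> v"
  using assms by (auto simp: all_edges_def)

lemma finite_all_edges:
  assumes "finite V"
  shows "finite (all_edges V)"
  by (rule finite_subset[of _ "Pow V"]) (use assms in \<open>auto simp: all_edges_def\<close>)

lemma non_edges_subset: "non_edges G \<subseteq> all_edges (verts G)"
  by (auto simp: non_edges_def)

lemma finite_non_edges:
  assumes "finite_simple_graph G"
  shows "finite (non_edges G)"
  using assms finite_all_edges non_edges_subset finite_subset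
  unfolding finite_simple_graph_def by metis

lemma doubleton_in_crossing [simp]:
  "{u, v} \<in> crossing A B \<longleftrightarrow> u \<in> A \<and> v \<in> B \<or> v \<in> A \<and> u \<in> B"
  unfolding crossing_def mem_Collect_eq doubleton_eq_iff by blast

lemma crossing_mono: "A \<subseteq> A' \<Longrightarrow> B \<subseteq> B' \<Longrightarrow> crossing A B \<subseteq> crossing A' B'"
  by (auto simp: crossing_def)

lemma card_crossing:
  assumes "A \<inter> B = {}"
  shows "card (crossing A B) = card A * card B"
proof -
  have "crossing A B = (\<lambda>(u, v). {u, v}) ` (A \<times> B)"
    by (auto simp: crossing_def)
  moreover have "inj_on (\<lambda>(u, v). {u, v}) (A \<times> B)"
    using assms by (auto simp: inj_on_def doubleton_eq_iff)
  ultimately show ?thesis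
    by (simp add: card_image card_cartesian_product)
qed

lemma crossing_subset_all_edges:
  assumes "balanced_partition V V1 V2"
  shows "crossing V1 V2 \<subseteq> all_edges V"
  using assms by (auto simp: balanced_partition_def crossing_def)

lemma card_crossing_balanced:
  assumes "finite V" "balanced_partition V V1 V2"
  shows "card (crossing V1 V2) = (card V div 2) * ((card V + 1) div 2)"
proof -
  have V: "V = V1 \<union> V2" "V1 \<inter> V2 = {}" "\<bar>int (card V1) - int (card V2)\<bar> \<le> 1"
    using assms by (auto simp: balanced_partition_def)
  have c: "card V = card V1 + card V2"
    using V assms(1) by (simp add: card_Un_disjoint)
  consider "card V1 = card V2" | "card V1 = Suc (card V2)" | "card V2 = Suc (card V1)"
    using V(3) by linarith
  then have "card V1 * card V2 = (card V div 2) * ((card V + 1) div 2)"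
    by cases (auto simp: c)
  then show ?thesis
    using V(2) by (simp add: card_crossing)
qed

lemma negative_edges_eq_crossing:
  assumes "\<forall>e\<in>edges G. \<sigma> e = -1 \<longleftrightarrow> (\<exists>u\<in>V1. \<exists>v\<in>V2. e = {u, v})"
  shows "negative_edges G \<sigma> = edges G \<inter> crossing V1 V2"
  using assms unfolding negative_edges_def crossing_def by blast

lemma card_edges_crossing:
  assumes "finite_simple_graph G" "balanced_partition (verts G) V1 V2"
  shows "card (edges G \<inter> crossing V1 V2) + card (non_edges G \<inter> crossing V1 V2)
    = (card (verts G) div 2) * ((card (verts G) + 1) div 2)"
proof -
  have fin: "finite (verts G)" and sub: "edges G \<subseteq> all_edges (verts G)"
    using assms(1) by (auto simp: finite_simple_graph_def)
  have "crossing V1 V2 = (edges G \<inter> crossing V1 V2) \<union> (non_edges G \<inter> crossing V1 V2)"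
    using crossing_subset_all_edges[OF assms(2)] by (auto simp: non_edges_def)
  moreover have "finite (edges G)"
    using sub fin finite_all_edges finite_subset by blast
  ultimately have "card (crossing V1 V2)
      = card (edges G \<inter> crossing V1 V2) + card (non_edges G \<inter> crossing V1 V2)"
    using finite_non_edges[OF assms(1)]
    by (metis (no_types, lifting) card_Un_disjoint finite_Int Int_Diff Diff_disjoint
        non_edges_def inf_assoc inf_commute inf_bot_right)
  then show ?thesis
    using card_crossing_balanced[OF fin assms(2)] by simp
qed

lemma rna_attained:
  assumes "finite_simple_graph G"
  obtains V1 V2 where "balanced_partition (verts G) V1 V2"
    "rna G + card (non_edges G \<inter> crossing V1 V2)
      = (card (verts G) div 2) * ((card (verts G) + 1) div 2)"
proof -
  have "rna G \<in> {card (negative_edges G \<sigma>) | \<sigma>. parity_signature G \<sigma>}"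
    unfolding rna_def
    by (rule Min_in) (use finite_rna_set[OF assms] ex_parity_signature[OF assms] in auto)
  then obtain \<sigma> where \<sigma>: "rna G = card (negative_edges G \<sigma>)" "parity_signature G \<sigma>"
    by blast
  obtain V1 V2 where V: "balanced_partition (verts G) V1 V2"
    "\<forall>e\<in>edges G. \<sigma> e = -1 \<longleftrightarrow> (\<exists>u\<in>V1. \<exists>v\<in>V2. e = {u, v})"
    using \<sigma>(2) unfolding parity_signature_def by (elim conjE exE)
  show thesis
    using that[OF V(1)] card_edges_crossing[OF assms V(1)] \<sigma>(1) negative_edges_eq_crossing[OF V(2)]
    by simp
qed

lemma rna_le_edges_crossing:
  assumes "finite_simple_graph G" "balanced_partition (verts G) V1 V2"
  shows "rna G \<le> card (edges G \<inter> crossing V1 V2)"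
proof -
  define \<sigma> :: "'a set \<Rightarrow> int"
    where "\<sigma> = (\<lambda>e. if \<exists>u\<in>V1. \<exists>v\<in>V2. e = {u, v} then -1 else 1)"
  have \<sigma>: "\<forall>e\<in>edges G. \<sigma> e = -1 \<longleftrightarrow> (\<exists>u\<in>V1. \<exists>v\<in>V2. e = {u, v})"
    by (auto simp: \<sigma>_def)
  have "parity_signature G \<sigma>"
    unfolding parity_signature_def using assms(2) \<sigma> by (auto simp: \<sigma>_def)
  then have "rna G \<le> card (negative_edges G \<sigma>)"
    unfolding rna_def using finite_rna_set[OF assms(1)] by (intro Min_le) auto
  then show ?thesis
    using negative_edges_eq_crossing[OF \<sigma>] by simp
qed

lemma balanced_partition_commute:
  "balanced_partition V V1 V2 \<longleftrightarrow> balanced_partition V V2 V1"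
  unfolding balanced_partition_def by (auto simp: Un_commute Int_commute)

lemma balanced_partition_extend:
  assumes "finite V" "A \<subseteq> V" "B \<subseteq> V" "A \<inter> B = {}"
    and "card A \<le> (card V + 1) div 2" "card B \<le> (card V + 1) div 2"
  shows "\<exists>V1 V2. balanced_partition V V1 V2 \<and> A \<subseteq> V1 \<and> B \<subseteq> V2"
  using assms
proof (induction "card A" "card B" arbitrary: A B rule: linorder_wlog)
  case le
  have "card A + card B \<le> card V"
    using le by (metis card_Un_disjoint card_mono finite_subset Un_least)
  moreover have "card (V - A) = card V - card A"
    using le by (meson card_Diff_subset finite_subset)
  ultimately have "(card V + 1) div 2 \<le> card (V - A)"
    using le by linarith
  then obtain V2 where V2: "B \<subseteq> V2" "V2 \<subseteq> V - A" "card V2 = (card V + 1) div 2"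
    using le exists_subset_between[of B "(card V + 1) div 2" "V - A"] by auto
  then have "card (V - V2) = card V - (card V + 1) div 2"
    using le by (metis card_Diff_subset finite_subset Diff_subset order_trans)
  then have "balanced_partition V (V - V2) V2"
    using V2 unfolding balanced_partition_def by auto
  then show ?case
    using V2 le by blast
next
  case sym
  then show ?case
    by (metis balanced_partition_commute inf_commute)
qed

lemma rna_le_of_cut:
  assumes "finite_simple_graph G" "A \<subseteq> verts G" "B \<subseteq> verts G" "A \<inter> B = {}"
    and "card A \<le> (card (verts G) + 1) div 2" "card B \<le> (card (verts G) + 1) div 2"
    and "F \<subseteq> non_edges G" "F \<subseteq> crossing A B"
  shows "rna G + card F \<le> (card (verts G) div 2) * ((card (verts G) + 1) div 2)"
proof -
  obtain V1 V2 where V: "balanced_partition (verts G) V1 V2" "A \<subseteq> V1" "B \<subseteq> V2"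
    using balanced_partition_extend[OF _ assms(2-6)] assms(1)
    by (auto simp: finite_simple_graph_def)
  have "F \<subseteq> non_edges G \<inter> crossing V1 V2"
    using assms(7,8) crossing_mono[OF V(2,3)] by blast
  then have "card F \<le> card (non_edges G \<inter> crossing V1 V2)"
    using finite_non_edges[OF assms(1)] by (intro card_mono) auto
  then show ?thesis
    using rna_le_edges_crossing[OF assms(1) V(1)] card_edges_crossing[OF assms(1) V(1)] by simp
qed

lemma two_edges_cases:
  assumes "e \<in> all_edges V" "f \<in> all_edges V" "e \<noteq> f"
  obtains (disjoint) a b c d where "e = {a, b}" "f = {c, d}" "distinct [a, b, c, d]"
      "{a, b, c, d} \<subseteq> V"
  | (adjacent) a b c where "e = {a, b}" "f = {a, c}" "distinct [a, b, c]" "{a, b, c} \<subseteq> V"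
proof -
  obtain a b where ab: "e = {a, b}" "a \<in> V" "b \<in> V" "a \<noteq> b"
    using assms(1) by (rule all_edgesE)
  obtain c d where cd: "f = {c, d}" "c \<in> V" "d \<in> V" "c \<noteq> d"
    using assms(2) by (rule all_edgesE)
  consider "distinct [a, b, c, d]" | "c = a" | "c = b" | "d = a" | "d = b"
    using ab cd by auto
  then show thesis
  proof cases
    case 1
    then show thesis using disjoint[of a b c d] ab cd by auto
  next
    case 2
    then show thesis using adjacent[of a b d] ab cd assms(3) by auto
  next
    case 3
    then show thesis using adjacent[of b a d] ab cd assms(3) by auto
  next
    case 4
    then show thesis using adjacent[of a b c] ab cd assms(3) by auto
  next
    case 5
    then show thesis using adjacent[of b a c] ab cd assms(3) by auto
  qed
qed

lemma rna_le_of_list_cut: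
  assumes "finite_simple_graph G" "distinct (xs @ ys)" "set (xs @ ys) \<subseteq> verts G"
    and "length xs \<le> length ys" "length ys \<le> length xs + 1 \<or> 2 * length ys \<le> card (verts G) + 1"
    and "F \<subseteq> non_edges G" "F \<subseteq> crossing (set xs) (set ys)" "card F = k"
  shows "rna G + k \<le> (card (verts G) div 2) * ((card (verts G) + 1) div 2)"
proof -
  have "finite (verts G)"
    using assms(1) by (simp add: finite_simple_graph_def)
  then have "length (xs @ ys) \<le> card (verts G)"
    using assms(2,3) by (metis distinct_card card_mono)
  then have "length xs \<le> (card (verts G) + 1) div 2" "length ys \<le> (card (verts G) + 1) div 2"
    using assms(4,5) by auto
  moreover have "card (set xs) = length xs" "card (set ys) = length ys"
    using assms(2) by (simp_all add: distinct_card)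
  ultimately show ?thesis
    using rna_le_of_cut[OF assms(1), of "set xs" "set ys" F] assms by simp
qed

lemma rna_le_one_non_edge:
  assumes "finite_simple_graph G" "e \<in> non_edges G"
  shows "rna G + 1 \<le> (card (verts G) div 2) * ((card (verts G) + 1) div 2)"
proof -
  obtain a b where e: "e = {a, b}" "a \<in> verts G" "b \<in> verts G" "a \<noteq> b"
    using assms(2) non_edges_subset by (blast elim: all_edgesE)
  show ?thesis
    by (rule rna_le_of_list_cut[of _ "[a]" "[b]" "{e}"]) (use assms e in simp_all)
qed

lemma rna_le_two_non_edges:
  assumes "finite_simple_graph G" "e \<in> non_edges G" "f \<in> non_edges G" "e \<noteq> f"
  shows "rna G + 2 \<le> (card (verts G) div 2) * ((card (verts G) + 1) div 2)"
proof -
  have F: "{e, f} \<subseteq> non_edges G" "card {e, f} = 2"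
    using assms by simp_all
  have "e \<in> all_edges (verts G)" "f \<in> all_edges (verts G)"
    using assms non_edges_subset by auto
  then show ?thesis
    using assms(4)
  proof (cases rule: two_edges_cases)
    case (disjoint a b c d)
    show ?thesis
      by (rule rna_le_of_list_cut[OF assms(1) _ _ _ _ F(1) _ F(2), of "[a, c]" "[b, d]"])
        (use disjoint in auto)
  next
    case (adjacent a b c)
    show ?thesis
      by (rule rna_le_of_list_cut[OF assms(1) _ _ _ _ F(1) _ F(2), of "[a]" "[b, c]"])
        (use adjacent in auto)
  qed
qed

lemma connected_graph_neighbour:
  assumes "connected_graph G" "u \<in> verts G" "v \<in> verts G" "u \<noteq> v"
  shows "\<exists>w. {u, w} \<in> edges G"
proof -
  have "(\<lambda>x y. {x, y} \<in> edges G)\<^sup>*\<^sup>* u v"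
    using assms by (auto simp: connected_graph_def)
  then show ?thesis
    using assms(4) by (auto elim: converse_rtranclpE)
qed

lemma non_edges_star_card:
  assumes "finite_simple_graph G" "connected_graph G" "distinct [a, b, c, x]"
    and "{{a, b}, {a, c}, {a, x}} \<subseteq> non_edges G"
  shows "5 \<le> card (verts G)"
proof (rule ccontr)
  assume less: "\<not> 5 \<le> card (verts G)"
  have fin: "finite (verts G)" and sub: "edges G \<subseteq> all_edges (verts G)"
    using assms(1) by (auto simp: finite_simple_graph_def)
  have V: "{a, b, c, x} \<subseteq> verts G"
    using assms(4) by (auto simp: non_edges_def)
  moreover have "card {a, b, c, x} = 4"
    using assms(3) by auto
  ultimately have eq: "verts G = {a, b, c, x}"
    using less card_seteq[OF fin V] by simp
  obtain w where w: "{a, w} \<in> edges G"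
    using connected_graph_neighbour[OF assms(2), of a b] V assms(3) by auto
  then have "{a, w} \<in> all_edges {a, b, c, x}"
    using sub unfolding eq by (rule subsetD[rotated])
  then have "w \<in> {b, c, x}"
    unfolding doubleton_in_all_edges by blast
  then show False
    using w assms(4) by (auto simp: non_edges_def)
qed

lemma rna_le_adjacent_non_edges:
  assumes G: "finite_simple_graph G" "connected_graph G"
    and abc: "distinct [a, b, c]"
    and ne: "{a, b} \<in> non_edges G" "{a, c} \<in> non_edges G" "g \<in> non_edges G"
    and g: "g \<notin> {{a, b}, {a, c}, {b, c}}"
  shows "rna G + 3 \<le> (card (verts G) div 2) * ((card (verts G) + 1) div 2)"
proof -
  let ?F = "{{a, b}, {a, c}, g}"
  obtain x y where xy: "g = {x, y}" "x \<in> verts G" "y \<in> verts G" "x \<noteq> y"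
    using ne(3) non_edges_subset by (blast elim: all_edgesE)
  have V: "a \<in> verts G" "b \<in> verts G" "c \<in> verts G"
    using ne by (auto simp: non_edges_def)
  have F: "?F \<subseteq> non_edges G"
    using ne by simp
  have "{a, b} \<noteq> {a, c}" "g \<noteq> {a, b}" "g \<noteq> {a, c}"
    using abc g by (simp_all add: doubleton_eq_iff)
  then have F3: "card ?F = 3"
    by (metis card_3_iff)
  have abc': "a \<noteq> b" "b \<noteq> a" "a \<noteq> c" "c \<noteq> a" "b \<noteq> c" "c \<noteq> b"
    using abc by auto
  note cut = rna_le_of_list_cut[OF G(1) _ _ _ _ F _ F3]
  have star: ?thesis if z: "g = {a, z}" "z \<in> verts G" "z \<noteq> a" for z
  proof -
    have "z \<noteq> b" "z \<noteq> c"
      using z g by blast+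
    then have d: "distinct [a, b, c, z]"
      using z abc by simp
    then have "5 \<le> card (verts G)"
      by (rule non_edges_star_card[OF G _ F[unfolded z(1)]])
    then show ?thesis
      by (intro cut[of "[a]" "[b, c, z]"]) (use d z V in simp_all)
  qed
  have other: ?thesis if xy: "g = {x, y}" "x \<in> verts G" "y \<in> verts G" "x \<noteq> y" "a \<notin> g" "y \<notin> {b, c}"
    for x y
  proof -
    consider "x = b" | "x = c" | "x \<notin> {a, b, c}"
      using xy by blast
    then show ?thesis
    proof cases
      case 1
      show ?thesis
        by (rule cut[of "[b, c]" "[a, y]"]) (use 1 xy abc' V in auto)
    next
      case 2
      show ?thesis
        by (rule cut[of "[b, c]" "[a, y]"]) (use 2 xy abc' V in auto)
    next
      case 3
      show ?thesis
        by (rule cut[of "[a, x]" "[b, c, y]"]) (use 3 xy abc' V in auto)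
    qed
  qed
  consider "x = a" | "y = a" | "a \<notin> g" "y \<notin> {b, c}" | "a \<notin> g" "x \<notin> {b, c}"
    | "x \<in> {b, c}" "y \<in> {b, c}"
    using xy(1) by blast
  then show ?thesis
  proof cases
    case 1
    then show ?thesis using star[of y] xy by blast
  next
    case 2
    then show ?thesis using star[of x] xy by blast
  next
    case 3
    then show ?thesis using other[of x y] xy by blast
  next
    case 4
    then show ?thesis using other[of y x] xy by blast
  next
    case 5
    then have "g = {b, c}"
      using xy(1,4) by blast
    then show ?thesis using g by blast
  qed
qed

lemma rna_le_disjoint_non_edges:
  assumes "finite_simple_graph G" "{e, f, g} \<subseteq> non_edges G"
    and "e \<inter> f = {}" "e \<inter> g = {}" "f \<inter> g = {}"
  shows "rna G + 3 \<le> (card (verts G) div 2) * ((card (verts G) + 1) div 2)"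
proof -
  have E: "e \<in> all_edges (verts G)" "f \<in> all_edges (verts G)" "g \<in> all_edges (verts G)"
    using assms(2) non_edges_subset by auto
  obtain a a' where e: "e = {a, a'}" "a \<in> verts G" "a' \<in> verts G" "a \<noteq> a'"
    using E(1) by (rule all_edgesE)
  obtain b b' where f: "f = {b, b'}" "b \<in> verts G" "b' \<in> verts G" "b \<noteq> b'"
    using E(2) by (rule all_edgesE)
  obtain c c' where g: "g = {c, c'}" "c \<in> verts G" "c' \<in> verts G" "c \<noteq> c'"
    using E(3) by (rule all_edgesE)
  have d: "distinct ([a, b, c] @ [a', b', c'])"
    using assms(3-5) e f g by auto
  have F: "card {e, f, g} = 3"
    using d unfolding e(1) f(1) g(1) by (simp add: doubleton_eq_iff)
  show ?thesis
    by (rule rna_le_of_list_cut[OF assms(1) d _ _ _ assms(2) _ F])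
      (use e f g in simp_all)
qed

definition is_triangle :: "'a set \<Rightarrow> 'a set set \<Rightarrow> bool" where
  "is_triangle V F \<longleftrightarrow> (\<exists>a b c. distinct [a, b, c] \<and> {a, b, c} \<subseteq> V
     \<and> F = {{a, b}, {b, c}, {a, c}})"

lemma rna_le_three_non_edges:
  assumes G: "finite_simple_graph G" "connected_graph G"
    and "3 \<le> card (non_edges G)" "\<not> is_triangle (verts G) (non_edges G)"
  shows "rna G + 3 \<le> (card (verts G) div 2) * ((card (verts G) + 1) div 2)"
proof (cases "\<exists>e\<in>non_edges G. \<exists>f\<in>non_edges G. e \<noteq> f \<and> e \<inter> f \<noteq> {}")
  case True
  then obtain e f where ef: "e \<in> non_edges G" "f \<in> non_edges G" "e \<noteq> f" "e \<inter> f \<noteq> {}"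
    by blast
  then have "e \<in> all_edges (verts G)" "f \<in> all_edges (verts G)"
    using non_edges_subset by auto
  then show ?thesis
    using ef(3)
  proof (cases rule: two_edges_cases)
    case (disjoint a b c d)
    then show ?thesis using ef(4) by auto
  next
    case (adjacent a b c)
    have "\<not> non_edges G \<subseteq> {{a, b}, {a, c}, {b, c}}"
    proof
      assume sub: "non_edges G \<subseteq> {{a, b}, {a, c}, {b, c}}"
      have "card {{a, b}, {a, c}, {b, c}} \<le> card (non_edges G)"
        using assms(3) by (simp add: card_insert_if)
      then have "non_edges G = {{a, b}, {a, c}, {b, c}}"
        using sub by (intro card_seteq) auto
      then have "non_edges G = {{a, b}, {b, c}, {a, c}}"
        by auto
      then show False
        using assms(4) adjacent(3,4) unfolding is_triangle_def by blast
    qed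
    then obtain g where "g \<in> non_edges G" "g \<notin> {{a, b}, {a, c}, {b, c}}"
      by blast
    then show ?thesis
      using rna_le_adjacent_non_edges[OF G adjacent(3)] ef adjacent by auto
  qed
next
  case False
  obtain F where "F \<subseteq> non_edges G" "card F = 3"
    using obtain_subset_with_card_n[OF assms(3)] by metis
  then obtain e f g where "{e, f, g} \<subseteq> non_edges G" "e \<noteq> f" "e \<noteq> g" "f \<noteq> g"
    by (auto simp: card_3_iff)
  then show ?thesis
    using False by (intro rna_le_disjoint_non_edges[OF G(1), of e f g]) auto
qed

lemma card_triangle:
  assumes "is_triangle V F"
  shows "card F = 3"
  using assms by (auto simp: is_triangle_def doubleton_eq_iff)

lemma card_triangle_crossing_le:
  assumes "is_triangle V F" "balanced_partition V V1 V2"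
  shows "card (F \<inter> crossing V1 V2) \<le> 2"
proof -
  obtain a b c where abc: "distinct [a, b, c]" "{a, b, c} \<subseteq> V" "F = {{a, b}, {b, c}, {a, c}}"
    using assms(1) unfolding is_triangle_def by blast
  have "\<not> F \<subseteq> crossing V1 V2"
    using abc assms(2) by (auto simp: balanced_partition_def crossing_def doubleton_eq_iff)
  then have "F \<inter> crossing V1 V2 \<subset> F"
    by blast
  moreover have "finite F"
    using abc(3) by simp
  ultimately have "card (F \<inter> crossing V1 V2) < card F"
    by (rule psubset_card_mono[rotated])
  then show ?thesis
    using card_triangle[OF assms(1)] by simp
qed

lemma rna_add_non_edges:
  assumes "finite_simple_graph G" "card (non_edges G) \<le> 2"
  shows "rna G + card (non_edges G) = (card (verts G) div 2) * ((card (verts G) + 1) div 2)"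
proof (rule antisym)
  have "card (non_edges G) = 0 \<or> card (non_edges G) = 1 \<or> card (non_edges G) = 2"
    using assms(2) by linarith
  then show "rna G + card (non_edges G) \<le> (card (verts G) div 2) * ((card (verts G) + 1) div 2)"
  proof (elim disjE)
    assume "card (non_edges G) = 0"
    then show ?thesis
      using rna_attained[OF assms(1)] by (metis le_add1 add_0_right)
  next
    assume "card (non_edges G) = 1"
    then show ?thesis
      using rna_le_one_non_edge[OF assms(1)] by (auto simp: card_1_singleton_iff)
  next
    assume "card (non_edges G) = 2"
    then show ?thesis
      using rna_le_two_non_edges[OF assms(1)] by (metis card_2_iff insertI1 insertI2)
  qed
next
  obtain V1 V2 where "rna G + card (non_edges G \<inter> crossing V1 V2)
      = (card (verts G) div 2) * ((card (verts G) + 1) div 2)"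
    using rna_attained[OF assms(1)] by metis
  moreover have "card (non_edges G \<inter> crossing V1 V2) \<le> card (non_edges G)"
    by (intro card_mono finite_non_edges[OF assms(1)]) auto
  ultimately show "(card (verts G) div 2) * ((card (verts G) + 1) div 2) \<le> rna G + card (non_edges G)"
    by linarith
qed

lemma rna_add_triangle:
  assumes "finite_simple_graph G" "is_triangle (verts G) (non_edges G)"
  shows "rna G + 2 = (card (verts G) div 2) * ((card (verts G) + 1) div 2)"
proof (rule antisym)
  obtain e f g where "non_edges G = {e, f, g}" "e \<noteq> f"
    using card_triangle[OF assms(2)] by (auto simp: card_3_iff)
  then show "rna G + 2 \<le> (card (verts G) div 2) * ((card (verts G) + 1) div 2)"
    using rna_le_two_non_edges[OF assms(1), of e f] by auto
next
  obtain V1 V2 where "balanced_partition (verts G) V1 V2"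
    "rna G + card (non_edges G \<inter> crossing V1 V2)
      = (card (verts G) div 2) * ((card (verts G) + 1) div 2)"
    using rna_attained[OF assms(1)] by metis
  then show "(card (verts G) div 2) * ((card (verts G) + 1) div 2) \<le> rna G + 2"
    using card_triangle_crossing_le[OF assms(2)] by fastforce
qed

lemma complete_graph_simps [simp]:
  "verts (complete_graph n) = {..<n}" "edges (complete_graph n) = all_edges {..<n}"
  by (simp_all add: complete_graph_def)

lemma iso_delete_edges_iff:
  assumes "finite_simple_graph G" "F \<subseteq> all_edges {..<n}"
  shows "G \<cong>\<^sub>g delete_edges (complete_graph n) F
    \<longleftrightarrow> (\<exists>f. bij_betw f (verts G) {..<n} \<and> F = (`) f ` non_edges G)"
proof -
  have eq: "(\<forall>u\<in>verts G. \<forall>v\<in>verts G. {u, v} \<in> edges G \<longleftrightarrow> {f u, f v} \<in> all_edges {..<n} - F)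
      \<longleftrightarrow> F = (`) f ` non_edges G" (is "?L \<longleftrightarrow> ?R") if f: "bij_betw f (verts G) {..<n}" for f
  proof
    assume L: ?L
    show ?R
    proof (intro equalityI subsetI)
      fix e
      assume e: "e \<in> F"
      then obtain x y where xy: "e = {x, y}" "x \<in> {..<n}" "y \<in> {..<n}" "x \<noteq> y"
        using assms(2) by (blast elim: all_edgesE)
      then obtain u v where uv: "u \<in> verts G" "x = f u" "v \<in> verts G" "y = f v"
        using f by (metis bij_betw_imp_surj_on imageE)
      then have "{u, v} \<in> non_edges G"
        using L e xy by (auto simp: non_edges_def)
      then show "e \<in> (`) f ` non_edges G"
        using uv xy by (intro image_eqI[of _ _ "{u, v}"]) auto
    next
      fix e
      assume "e \<in> (`) f ` non_edges G"
      then obtain h where h: "h \<in> non_edges G" "e = f ` h"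
        by blast
      obtain u v where "h = {u, v}" "u \<in> verts G" "v \<in> verts G" "u \<noteq> v"
        using subsetD[OF non_edges_subset h(1)] by (rule all_edgesE)
      with h have uv: "e = {f u, f v}" "{u, v} \<in> non_edges G" "u \<in> verts G" "v \<in> verts G" "u \<noteq> v"
        by simp_all
      moreover have "f u \<noteq> f v" "f u < n" "f v < n"
        using uv f by (auto simp: bij_betw_def inj_on_def)
      ultimately show "e \<in> F"
        using L by (auto simp: non_edges_def)
    qed
  next
    assume R: ?R
    show ?L
    proof (intro ballI)
      fix u v
      assume uv: "u \<in> verts G" "v \<in> verts G"
      have inj: "inj_on ((`) f) (Pow (verts G))"
        using f by (simp add: bij_betw_def inj_on_image_Pow)
      have "non_edges G \<subseteq> Pow (verts G)"
        by (auto simp: non_edges_def all_edges_def)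
      then have "f ` {u, v} \<in> F \<longleftrightarrow> {u, v} \<in> non_edges G"
        unfolding R using uv by (intro inj_on_image_mem_iff[OF inj]) auto
      moreover have "{f u, f v} \<in> all_edges {..<n} \<longleftrightarrow> {u, v} \<in> all_edges (verts G)"
        using uv f by (auto simp: bij_betw_def inj_on_def)
      moreover have "{u, v} \<in> edges G \<Longrightarrow> {u, v} \<in> all_edges (verts G)"
        using assms(1) unfolding finite_simple_graph_def by blast
      ultimately show "{u, v} \<in> edges G \<longleftrightarrow> {f u, f v} \<in> all_edges {..<n} - F"
        unfolding non_edges_def image_insert image_empty by blast
    qed
  qed
  show ?thesis
    unfolding graph_iso_def delete_edges_def complete_graph_simps ugraph.simps
    by (intro iff_exI conj_cong refl eq)
qed

lemma bij_betw_image_edges: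
  assumes "bij_betw f V W" "F \<subseteq> all_edges V"
  shows "(`) f ` F \<subseteq> all_edges W" "card ((`) f ` F) = card F"
proof -
  show "(`) f ` F \<subseteq> all_edges W"
  proof (intro image_subsetI)
    fix e
    assume "e \<in> F"
    then obtain u v where "e = {u, v}" "u \<in> V" "v \<in> V" "u \<noteq> v"
      using assms(2) by (blast elim: all_edgesE)
    then show "f ` e \<in> all_edges W"
      using assms(1) by (auto simp: bij_betw_def inj_on_def)
  qed
  have "inj_on ((`) f) (Pow V)"
    using assms(1) by (simp add: bij_betw_def inj_on_image_Pow)
  moreover have "F \<subseteq> Pow V"
    using assms(2) by (auto simp: all_edges_def)
  ultimately show "card ((`) f ` F) = card F"
    by (meson card_image inj_on_subset)
qed

lemma is_triangle_image:
  assumes "bij_betw f V W" "is_triangle V F"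
  shows "is_triangle W ((`) f ` F)"
proof -
  obtain a b c where abc: "distinct [a, b, c]" "{a, b, c} \<subseteq> V" "F = {{a, b}, {b, c}, {a, c}}"
    using assms(2) unfolding is_triangle_def by blast
  have "distinct [f a, f b, f c]" "{f a, f b, f c} \<subseteq> W"
    using abc(1,2) assms(1) by (auto simp: bij_betw_def inj_on_def)
  moreover have "(`) f ` F = {{f a, f b}, {f b, f c}, {f a, f c}}"
    using abc(3) by auto
  ultimately show ?thesis
    unfolding is_triangle_def by blast
qed

lemma is_triangle_image_iff:
  assumes "bij_betw f V W" "F \<subseteq> all_edges V"
  shows "is_triangle W ((`) f ` F) \<longleftrightarrow> is_triangle V F"
proof
  assume "is_triangle W ((`) f ` F)"
  then have "is_triangle V ((`) (inv_into V f) ` (`) f ` F)"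
    by (rule is_triangle_image[OF bij_betw_inv_into[OF assms(1)]])
  moreover have "(`) (inv_into V f) ` (`) f ` F = F"
  proof -
    have "inv_into V f ` f ` e = e" if "e \<in> F" for e
      using that assms by (intro inv_into_image_cancel) (auto simp: bij_betw_def all_edges_def)
    then show ?thesis
      by (simp add: image_image)
  qed
  ultimately show "is_triangle V F"
    by simp
qed (rule is_triangle_image[OF assms(1)])

lemma ex_iso_delete_edges_iff:
  assumes "finite_simple_graph G" "card (verts G) = n"
    and P: "\<And>f. bij_betw f (verts G) {..<n} \<Longrightarrow> P ((`) f ` non_edges G) \<longleftrightarrow> Q"
  shows "(\<exists>F\<subseteq>all_edges {..<n}. P F \<and> G \<cong>\<^sub>g delete_edges (complete_graph n) F) \<longleftrightarrow> Q"
proof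
  assume "\<exists>F\<subseteq>all_edges {..<n}. P F \<and> G \<cong>\<^sub>g delete_edges (complete_graph n) F"
  then obtain F where "F \<subseteq> all_edges {..<n}" "P F" "G \<cong>\<^sub>g delete_edges (complete_graph n) F"
    by blast
  then show Q
    using iso_delete_edges_iff[OF assms(1)] P by metis
next
  assume Q
  obtain f where f: "bij_betw f (verts G) {..<n}"
    using assms(1,2) by (metis finite_simple_graph_def ex_bij_betw_finite_nat atLeast0LessThan)
  then have "(`) f ` non_edges G \<subseteq> all_edges {..<n}"
    using bij_betw_image_edges(1) non_edges_subset by metis
  then show "\<exists>F\<subseteq>all_edges {..<n}. P F \<and> G \<cong>\<^sub>g delete_edges (complete_graph n) F"
    using iso_delete_edges_iff[OF assms(1)] P[OF f] \<open>Q\<close> f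
    by (intro exI[of _ "(`) f ` non_edges G"] conjI) auto
qed

lemma ex_iso_delete_card_iff:
  assumes "finite_simple_graph G" "card (verts G) = n"
  shows "(\<exists>F\<subseteq>all_edges {..<n}. card F = k \<and> G \<cong>\<^sub>g delete_edges (complete_graph n) F)
    \<longleftrightarrow> card (non_edges G) = k"
  using ex_iso_delete_edges_iff[OF assms, where P = "\<lambda>F. card F = k"]
    bij_betw_image_edges(2) non_edges_subset by metis

lemma ex_singleton_subset_iff:
  "(\<exists>F\<subseteq>A. card F = 1 \<and> D F) \<longleftrightarrow> (\<exists>e\<in>A. D {e})"
  by (auto simp: card_1_singleton_iff)

lemma ex_doubleton_subset_iff:
  assumes "\<And>e f. e \<in> A \<Longrightarrow> X e f \<Longrightarrow> e \<noteq> f"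
  shows "(\<exists>F\<subseteq>A. card F = 2 \<and> D F) \<longleftrightarrow>
    (\<exists>e\<in>A. \<exists>f\<in>A. X e f \<and> D {e, f}) \<or> (\<exists>e\<in>A. \<exists>f\<in>A. e \<noteq> f \<and> \<not> X e f \<and> D {e, f})"
proof -
  have "(\<exists>F\<subseteq>A. card F = 2 \<and> D F) \<longleftrightarrow> (\<exists>e\<in>A. \<exists>f\<in>A. e \<noteq> f \<and> D {e, f})"
  proof
    assume "\<exists>F\<subseteq>A. card F = 2 \<and> D F"
    then show "\<exists>e\<in>A. \<exists>f\<in>A. e \<noteq> f \<and> D {e, f}"
      by (metis card_2_iff insert_subset)
  next
    assume "\<exists>e\<in>A. \<exists>f\<in>A. e \<noteq> f \<and> D {e, f}"
    then show "\<exists>F\<subseteq>A. card F = 2 \<and> D F"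
      by (metis card_2_iff insert_subset empty_subsetI)
  qed
  then show ?thesis
    using assms by blast
qed

lemma is_K_iff:
  assumes "finite_simple_graph G" "card (verts G) = n"
  shows "is_K n G \<longleftrightarrow> card (non_edges G) = 0"
proof -
  have "delete_edges (complete_graph n) {} = complete_graph n"
    by (simp add: delete_edges_def complete_graph_def)
  then have "is_K n G \<longleftrightarrow>
      (\<exists>F\<subseteq>all_edges {..<n}. card F = 0 \<and> G \<cong>\<^sub>g delete_edges (complete_graph n) F)"
    using finite_subset[OF _ finite_all_edges[OF finite_lessThan[of n]]]
    unfolding is_K_def by (metis card_eq_0_iff empty_subsetI)
  then show ?thesis
    by (simp only: ex_iso_delete_card_iff[OF assms])
qed

lemma is_K_minus_e_iff:
  assumes "finite_simple_graph G" "card (verts G) = n"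
  shows "is_K_minus_e n G \<longleftrightarrow> card (non_edges G) = 1"
  unfolding is_K_minus_e_def complete_graph_simps ex_iso_delete_card_iff[OF assms, symmetric]
  by (rule ex_singleton_subset_iff[symmetric])

lemma is_K_minus_two_edges_iff:
  assumes "finite_simple_graph G" "card (verts G) = n"
  shows "is_K_minus_2e n G \<or> is_K_minus_P2 n G \<longleftrightarrow> card (non_edges G) = 2"
  unfolding is_K_minus_2e_def is_K_minus_P2_def complete_graph_simps
    ex_iso_delete_card_iff[OF assms, symmetric]
  by (rule ex_doubleton_subset_iff[where X = "\<lambda>e f. e \<inter> f = {}", symmetric])
    (auto elim: all_edgesE)

lemma is_K_minus_triangle_iff:
  assumes "finite_simple_graph G" "card (verts G) = n"
  shows "is_K_minus_triangle n G \<longleftrightarrow> is_triangle (verts G) (non_edges G)"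
proof -
  have "is_K_minus_triangle n G \<longleftrightarrow> (\<exists>F\<subseteq>all_edges {..<n}. is_triangle {..<n} F
      \<and> G \<cong>\<^sub>g delete_edges (complete_graph n) F)" (is "_ \<longleftrightarrow> ?R")
  proof
    assume "is_K_minus_triangle n G"
    then obtain a b c where abc: "a < n" "b < n" "c < n" "distinct [a, b, c]"
      "G \<cong>\<^sub>g delete_edges (complete_graph n) {{a, b}, {b, c}, {a, c}}"
      unfolding is_K_minus_triangle_def by auto
    then have "is_triangle {..<n} {{a, b}, {b, c}, {a, c}}"
      unfolding is_triangle_def by (intro exI[of _ a] exI[of _ b] exI[of _ c]) auto
    then show ?R
      using abc by (intro exI[of _ "{{a, b}, {b, c}, {a, c}}"]) auto
  next
    assume ?R
    then obtain a b c where "a < n" "b < n" "c < n" "distinct [a, b, c]"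
      "G \<cong>\<^sub>g delete_edges (complete_graph n) {{a, b}, {b, c}, {a, c}}"
      unfolding is_triangle_def by auto
    then show "is_K_minus_triangle n G"
      unfolding is_K_minus_triangle_def
      by (intro bexI[of _ a] bexI[of _ b] bexI[of _ c]) simp_all
  qed
  also have "\<dots> \<longleftrightarrow> is_triangle (verts G) (non_edges G)"
    using ex_iso_delete_edges_iff[OF assms, where P = "is_triangle {..<n}"]
      is_triangle_image_iff non_edges_subset by metis
  finally show ?thesis .
qed

lemma ceiling_mult_floor_half:
  "\<lceil>real n / 2\<rceil> * \<lfloor>real n / 2\<rfloor> = int ((n div 2) * ((n + 1) div 2))"
proof (cases "even n")
  case True
  then obtain k where "n = 2 * k" by (rule evenE)
  then show ?thesis by simp
next
  case False
  then obtain k where k: "n = 2 * k + 1" by (rule oddE)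
  have "\<lceil>real n / 2\<rceil> = int k + 1" "\<lfloor>real n / 2\<rfloor> = int k"
    using k by linarith+
  then show ?thesis using k by (simp add: algebra_simps)
qed

theorem theorem1:
  fixes G :: "'a ugraph" and n :: nat
  assumes "finite_simple_graph G"
    and "connected_graph G"
    and "card (verts G) = n"
  shows "int (rna G) \<le> \<lceil>real n / 2\<rceil> * \<lfloor>real n / 2\<rfloor>
    \<and> (int (rna G) = \<lceil>real n / 2\<rceil> * \<lfloor>real n / 2\<rfloor> \<longleftrightarrow> is_K n G)
    \<and> (int (rna G) = \<lceil>real n / 2\<rceil> * \<lfloor>real n / 2\<rfloor> - 1 \<longleftrightarrow> is_K_minus_e n G)
    \<and> (int (rna G) = \<lceil>real n / 2\<rceil> * \<lfloor>real n / 2\<rfloor> - 2 \<longleftrightarrow>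
         is_K_minus_triangle n G \<or> is_K_minus_2e n G \<or> is_K_minus_P2 n G)"
proof -
  define N where "N = (n div 2) * ((n + 1) div 2)"
  let ?k = "card (non_edges G)" and ?T = "is_triangle (verts G) (non_edges G)"
  have small: "rna G + ?k = N" if "?k \<le> 2"
    using rna_add_non_edges[OF assms(1) that] assms(3) by (simp add: N_def)
  have triangle: "rna G + 2 = N \<and> ?k = 3" if ?T
    using rna_add_triangle[OF assms(1) that] card_triangle[OF that] assms(3) by (simp add: N_def)
  have large: "rna G + 3 \<le> N" if "3 \<le> ?k" "\<not> ?T"
    using rna_le_three_non_edges[OF assms(1,2) that] assms(3) by (simp add: N_def)
  have "int (rna G) \<le> int N \<and> (int (rna G) = int N \<longleftrightarrow> ?k = 0)
      \<and> (int (rna G) = int N - 1 \<longleftrightarrow> ?k = 1) \<and> (int (rna G) = int N - 2 \<longleftrightarrow> ?T \<or> ?k = 2)"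
  proof (cases "?k \<le> 2")
    case True
    then show ?thesis using small triangle by auto
  next
    case False
    then show ?thesis using triangle large by (cases ?T) auto
  qed
  then show ?thesis
    unfolding ceiling_mult_floor_half is_K_iff[OF assms(1,3)] is_K_minus_e_iff[OF assms(1,3)]
      is_K_minus_two_edges_iff[OF assms(1,3)] is_K_minus_triangle_iff[OF assms(1,3)] N_def .
qed

end
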